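(* Let $A$ be a self-adjoint operator, semi-bounded from below, on a Hilbert space $\mathcal{H}$, with spectral measure $E$. Let $a<b$ be real numbers in $\rho(A)$, $\Delta=[a,b]$, and suppose $\sigma(A)\cap\Delta=\{\lambda_1,\dots,\lambda_d\}\subset\sigma_{\mathrm{dis}}(A)$ with $d<\infty$. Fix $\lambda\in\{\lambda_1,\dots,\lambda_d\}$, put $\kappa=\dim\mathcal{L}(\{\lambda\})$, and fix $0<r<1/2$ such that \[ \mathbb{D}(\lambda+i,2r)\cap(\sigma(A)+i)=\{\lambda+i\}\quad\text{and}\quad\mathbb{D}(\lambda+i,2r)\cap\Gamma_{a,b}^{0,1}=\varnothing . \] Let $(P_n)_{n\in\mathbb{N}}$ be a sequence of orthogonal projections on $\mathcal{H}$ converging strongly to the identity, with ranges $\mathcal{L}_n$, and let $\varepsilon_n=\delta(\mathcal{L}(\Delta),\mathcal{L}_n)$. For all sufficiently large $n$, let $\mu_{n,1},\dots,\mu_{n,\kappa}$ be the (repeated) eigenvalues of $A+iP_n$ enclosed by the circle $|\lambda+i-z|=r$. Then \[ \max_{1\le j\le\kappa}|\lambda+i-\mu_{n,j}|=\mathcal{O}(\varepsilon_n^2)\quad\text{as }n\to\infty . \]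
   Context: $\mathbb{D}(x,y)$ is the closed disc in $\mathbb{C}$ with centre $x$ and radius $y$. For a Borel set $S\subset\mathbb{R}$, $\mathcal{L}(S)$ is the range of $E(S)$. $\sigma_{\mathrm{dis}}(A)$ is the discrete spectrum (isolated eigenvalues of finite multiplicity). For all sufficiently large $n$ the circle $|z-\lambda-i|=r$ lies in $\rho(A+iP_n)$ and encloses exactly $\kappa$ eigenvalues of $A+iP_n$, repeated according to algebraic multiplicity. For subspaces of $\mathcal{H}$, $\delta(\mathcal{M},\mathcal{N})=\sup_{u\in\mathcal{M},\|u\|=1}\mathrm{dist}(u,\mathcal{N})$. The curve $\Gamma_{a,b}^{0,1}$: if $b-a\le1$, then $\Gamma_{a,b}^{0,1}=\{x+ih_\pm(x):x\in[a,b]\}$ (both signs) with $h_\pm(x)=\frac12\pm\sqrt{\frac14+(x-a)(x-b)}$; if $b-a>1$, then $\Gamma_{a,b}^{0,1}=\{k_\pm(y)+iy:y\in[0,1]\}$ (both signs) with $k_\pm(y)=\frac{a+b}{2}\pm\sqrt{(\frac{b-a}{2})^2+y(y-1)}$. *)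

theory Defs
  imports "HOL-Analysis.Analysis" "HOL-Library.Landau_Symbols"
begin

text \<open>
  Complex Hilbert spaces. The inner product is conjugate-linear in its first argument.
\<close>

class chilbert_space = banach +
  fixes scaleC :: "complex \<Rightarrow> 'a \<Rightarrow> 'a"  (infixr \<open>*\<^sub>C\<close> 75)
    and cinner :: "'a \<Rightarrow> 'a \<Rightarrow> complex"
  assumes scaleC_add_right: "c *\<^sub>C (x + y) = c *\<^sub>C x + c *\<^sub>C y"
    and scaleC_add_left: "(c + d) *\<^sub>C x = c *\<^sub>C x + d *\<^sub>C x"
    and scaleC_scaleC: "c *\<^sub>C (d *\<^sub>C x) = (c * d) *\<^sub>C x"
    and scaleC_of_real: "complex_of_real t *\<^sub>C x = t *\<^sub>R x"
    and cinner_commute: "cinner x y = cnj (cinner y x)"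
    and cinner_add_right: "cinner x (y + z) = cinner x y + cinner x z"
    and cinner_scaleC_right: "cinner x (c *\<^sub>C y) = c * cinner x y"
    and cinner_self: "cinner x x = complex_of_real ((norm x)\<^sup>2)"

instantiation complex :: chilbert_space
begin
definition scaleC_complex :: "complex \<Rightarrow> complex \<Rightarrow> complex"
  where "scaleC_complex c z = c * z"
definition cinner_complex :: "complex \<Rightarrow> complex \<Rightarrow> complex"
  where "cinner_complex w z = cnj w * z"
instance
  by standard
    (auto simp: scaleC_complex_def cinner_complex_def algebra_simps scaleR_conv_of_real
       complex_norm_square[symmetric])
end

global_interpretation complex_vector: vector_space "scaleC :: complex \<Rightarrow> 'a \<Rightarrow> 'a::chilbert_space"
proof
  show "1 *\<^sub>C x = x" for x :: 'a
    using scaleC_of_real[of 1 x] by simp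
qed (simp_all add: scaleC_add_right scaleC_add_left scaleC_scaleC)

definition finite_cdim :: "'a::chilbert_space set \<Rightarrow> bool"
  where "finite_cdim S \<longleftrightarrow> (\<exists>B. finite B \<and> S \<subseteq> complex_vector.span B)"

text \<open>
  A (possibly unbounded) operator consists of its domain and a function that is relevant on this
  domain only.
\<close>

record 'a operator =
  op_dom :: "'a set"
  op_fun :: "'a \<Rightarrow> 'a"

definition linear_operator :: "'a::chilbert_space operator \<Rightarrow> bool"
  where "linear_operator T \<longleftrightarrow> complex_vector.subspace (op_dom T) \<and>
    (\<forall>x\<in>op_dom T. \<forall>y\<in>op_dom T. op_fun T (x + y) = op_fun T x + op_fun T y) \<and>
    (\<forall>c. \<forall>x\<in>op_dom T. op_fun T (c *\<^sub>C x) = c *\<^sub>C op_fun T x)"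

definition op_graph :: "'a operator \<Rightarrow> ('a \<times> 'a) set"
  where "op_graph T = {(x, op_fun T x) |x. x \<in> op_dom T}"

definition adjoint_graph :: "'a::chilbert_space operator \<Rightarrow> ('a \<times> 'a) set"
  where "adjoint_graph T = {(v, w). \<forall>u\<in>op_dom T. cinner v (op_fun T u) = cinner w u}"

definition self_adjoint :: "'a::chilbert_space operator \<Rightarrow> bool"
  where "self_adjoint T \<longleftrightarrow>
    linear_operator T \<and> closure (op_dom T) = UNIV \<and> adjoint_graph T = op_graph T"

definition semibounded_below :: "'a::chilbert_space operator \<Rightarrow> bool"
  where "semibounded_below T \<longleftrightarrow>
    (\<exists>c::real. \<forall>x\<in>op_dom T. c * (norm x)\<^sup>2 \<le> Re (cinner x (op_fun T x)))"

definition resolvent_set :: "'a::chilbert_space operator \<Rightarrow> complex set"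
  where "resolvent_set T = {z. bij_betw (\<lambda>x. op_fun T x - z *\<^sub>C x) (op_dom T) UNIV \<and>
    (\<exists>c. \<forall>x\<in>op_dom T. norm x \<le> c * norm (op_fun T x - z *\<^sub>C x))}"

definition spectrum :: "'a::chilbert_space operator \<Rightarrow> complex set"
  where "spectrum T = - resolvent_set T"

definition eigenvalue :: "'a::chilbert_space operator \<Rightarrow> complex \<Rightarrow> bool"
  where "eigenvalue T z \<longleftrightarrow> (\<exists>x\<in>op_dom T. x \<noteq> 0 \<and> op_fun T x = z *\<^sub>C x)"

text \<open>The kernel of \<open>(T - z)\<^sup>k\<close>, on the domain of \<open>T\<^sup>k\<close>.\<close>

primrec power_kernel :: "'a::chilbert_space operator \<Rightarrow> complex \<Rightarrow> nat \<Rightarrow> 'a set" where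
  "power_kernel T z 0 = {0}"
| "power_kernel T z (Suc k) = {x \<in> op_dom T. op_fun T x - z *\<^sub>C x \<in> power_kernel T z k}"

definition generalized_eigenspace :: "'a::chilbert_space operator \<Rightarrow> complex \<Rightarrow> 'a set"
  where "generalized_eigenspace T z = (\<Union>k. power_kernel T z k)"

text \<open>As for all dimensions here, the value is \<open>0\<close> if the generalised eigenspace is
  infinite-dimensional.\<close>

definition algebraic_multiplicity :: "'a::chilbert_space operator \<Rightarrow> complex \<Rightarrow> nat"
  where "algebraic_multiplicity T z = complex_vector.dim (generalized_eigenspace T z)"

definition discrete_spectrum :: "'a::chilbert_space operator \<Rightarrow> complex set"
  where "discrete_spectrum T = {z. eigenvalue T z \<and> finite_cdim (generalized_eigenspace T z) \<and>
    (\<exists>e>0. ball z e \<inter> spectrum T = {z})}"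

text \<open>
  The \<open>m\<close> numbers \<open>\<mu> 1, \<dots>, \<mu> m\<close> are the eigenvalues of \<open>T\<close> in \<open>U\<close>, each repeated according to its
  algebraic multiplicity. The first conjunct excludes eigenvalues of infinite algebraic
  multiplicity, for which the second one alone would ask for no occurrence.
\<close>

definition repeated_eigenvalues_in ::
  "'a::chilbert_space operator \<Rightarrow> complex set \<Rightarrow> nat \<Rightarrow> (nat \<Rightarrow> complex) \<Rightarrow> bool"
  where "repeated_eigenvalues_in T U m \<mu> \<longleftrightarrow>
    \<mu> ` {1..m} = {z \<in> U. eigenvalue T z} \<and>
    (\<forall>z\<in>U. card {j \<in> {1..m}. \<mu> j = z} = algebraic_multiplicity T z)"

definition orthogonal_projection :: "('a::chilbert_space \<Rightarrow> 'a) \<Rightarrow> bool"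
  where "orthogonal_projection P \<longleftrightarrow> Vector_Spaces.linear scaleC scaleC P \<and>
    (\<forall>x. P (P x) = P x) \<and> (\<forall>x y. cinner (P x) y = cinner x (P y))"

definition add_i_times :: "'a::chilbert_space operator \<Rightarrow> ('a \<Rightarrow> 'a) \<Rightarrow> 'a operator"
  where "add_i_times T P = \<lparr>op_dom = op_dom T, op_fun = (\<lambda>x. op_fun T x + \<i> *\<^sub>C P x)\<rparr>"

definition projection_valued_measure :: "(real set \<Rightarrow> 'a::chilbert_space \<Rightarrow> 'a) \<Rightarrow> bool"
  where "projection_valued_measure E \<longleftrightarrow>
    (\<forall>S\<in>sets borel. orthogonal_projection (E S)) \<and>
    (\<forall>x. E UNIV x = x) \<and>
    (\<forall>S\<in>sets borel. \<forall>S'\<in>sets borel. \<forall>x. E (S \<inter> S') x = E S (E S' x)) \<and>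
    (\<forall>F. range F \<subseteq> sets borel \<longrightarrow> disjoint_family F \<longrightarrow>
      (\<forall>x. (\<lambda>n::nat. E (F n) x) sums E (\<Union>n. F n) x))"

text \<open>The finite Borel measure \<open>S \<mapsto> \<langle>x, E(S) x\<rangle>\<close>.\<close>

definition scalar_spectral_measure ::
  "(real set \<Rightarrow> 'a::chilbert_space \<Rightarrow> 'a) \<Rightarrow> 'a \<Rightarrow> real measure"
  where "scalar_spectral_measure E x =
    measure_of UNIV (sets borel) (\<lambda>S. ennreal (Re (cinner x (E S x))))"

text \<open>
  \<open>E\<close> is the spectral measure of \<open>T\<close>, i.e. \<open>T = \<integral> t dE(t)\<close>: the domain of \<open>T\<close> consists of the \<open>x\<close>
  with \<open>\<integral> t\<^sup>2 d\<langle>x, E(t) x\<rangle> < \<infinity>\<close>, and \<open>\<langle>x, T x\<rangle> = \<integral> t d\<langle>x, E(t) x\<rangle>\<close> on it. By polarization the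
  quadratic form determines the linear operator \<open>T\<close> on its dense domain.
\<close>

definition is_spectral_measure_of ::
  "(real set \<Rightarrow> 'a::chilbert_space \<Rightarrow> 'a) \<Rightarrow> 'a operator \<Rightarrow> bool"
  where "is_spectral_measure_of E T \<longleftrightarrow> projection_valued_measure E \<and>
    op_dom T = {x. (\<integral>\<^sup>+ t. ennreal (t\<^sup>2) \<partial>scalar_spectral_measure E x) < \<infinity>} \<and>
    (\<forall>x\<in>op_dom T. cinner x (op_fun T x) =
      complex_of_real (\<integral> t. t \<partial>scalar_spectral_measure E x))"

definition subspace_gap :: "'a::chilbert_space set \<Rightarrow> 'a set \<Rightarrow> real"
  where "subspace_gap M N = (SUP u\<in>{u \<in> M. norm u = 1}. infdist u N)"

definition Gamma_curve :: "real \<Rightarrow> real \<Rightarrow> complex set"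
  where "Gamma_curve a b =
    (if b - a \<le> 1
     then {Complex x (1/2 + s * sqrt (1/4 + (x - a) * (x - b))) |x s. x \<in> {a..b} \<and> s \<in> {1, -1}}
     else {Complex ((a + b)/2 + s * sqrt (((b - a)/2)\<^sup>2 + y * (y - 1))) y |y s.
             y \<in> {0..1} \<and> s \<in> {1, -1}})"

end

theory Submission
  imports Defs
begin

text \<open>
  Let \<open>u\<close> be an eigenvector of \<open>A + iP\<^sub>n\<close> for \<open>\<mu>\<close>, let \<open>G = E(\<Delta>)\<close>, \<open>Q = 1 - P\<^sub>n\<close>, and write
  \<open>u = v + w\<close> with \<open>v = Gu\<close>. On the range of \<open>1 - G\<close> the spectrum of \<open>A\<close> avoids \<open>[a,b]\<close>, so
  \<open>\<parallel>(A - c)w\<parallel> \<ge> h\<parallel>w\<parallel>\<close> for the midpoint \<open>c\<close> and half length \<open>h\<close> of \<open>\<Delta>\<close>. Comparing this with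
  \<open>\<parallel>P\<^sub>nw\<parallel>\<^sup>2 = \<langle>w, P\<^sub>nw\<rangle>\<close> shows that \<open>(1 - G)(A + iP\<^sub>n)(1 - G) - z\<close> is bounded below, uniformly in
  \<open>n\<close>, as long as \<open>f(z) = (Re z - a)(Re z - b) + Im z (1 - Im z)\<close> is negative; \<open>\<Gamma>\<close> is part of the zero
  set of \<open>f\<close>. Hence \<open>\<parallel>w\<parallel> \<le> C\<parallel>Qv\<parallel> \<le> C\<epsilon>\<^sub>n\<parallel>v\<parallel>\<close>. The other component of the eigenvalue equation is
  \<open>(A + i - \<mu>)v = iGQ(v + w)\<close>, and since \<open>\<parallel>GQ\<parallel> = \<parallel>QG\<parallel> \<le> \<epsilon>\<^sub>n\<close>, its right-hand side is
  \<open>O(\<epsilon>\<^sub>n\<^sup>2)\<parallel>v\<parallel>\<close>, whereas its left-hand side is at least \<open>|\<lambda> + i - \<mu>| \<parallel>v\<parallel>\<close>.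
\<close>

section \<open>Complex inner product\<close>

lemma cinner_add_left: "cinner (x + y) z = cinner x z + cinner y (z::'a::chilbert_space)"
  by (subst (1 2 3) cinner_commute) (simp add: cinner_add_right)

lemma cinner_scaleC_left: "cinner (c *\<^sub>C x) y = cnj c * cinner x (y::'a::chilbert_space)"
  by (subst (1 2) cinner_commute) (simp add: cinner_scaleC_right)

lemma cinner_zero_right [simp]: "cinner x (0::'a::chilbert_space) = 0"
  using cinner_add_right[of x 0 0] by simp

lemma cinner_zero_left [simp]: "cinner (0::'a::chilbert_space) x = 0"
  using cinner_add_left[of 0 0 x] by simp

lemma cinner_minus_right: "cinner x (- y) = - cinner x (y::'a::chilbert_space)"
  using cinner_add_right[of x "- y" y] by (intro iffD2[OF eq_neg_iff_add_eq_0]) simp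

lemma cinner_minus_left: "cinner (- x) y = - cinner x (y::'a::chilbert_space)"
  using cinner_add_left[of "- x" x y] by (intro iffD2[OF eq_neg_iff_add_eq_0]) simp

lemma cinner_diff_right: "cinner x (y - z) = cinner x y - cinner x (z::'a::chilbert_space)"
  using cinner_add_right[of x y "- z"] by (simp add: cinner_minus_right)

lemma cinner_diff_left: "cinner (x - y) z = cinner x z - cinner y (z::'a::chilbert_space)"
  using cinner_add_left[of x "- y" z] by (simp add: cinner_minus_left)

lemmas cinner_simps = cinner_add_left cinner_add_right cinner_diff_left cinner_diff_right
  cinner_scaleC_left cinner_scaleC_right cinner_minus_left cinner_minus_right

lemma Re_cinner_commute: "Re (cinner x y) = Re (cinner y (x::'a::chilbert_space))"
  by (subst cinner_commute) simp

lemma norm_scaleC [simp]: "norm (c *\<^sub>C x) = cmod c * norm (x::'a::chilbert_space)"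
proof -
  have "complex_of_real ((norm (c *\<^sub>C x))\<^sup>2) = cinner (c *\<^sub>C x) (c *\<^sub>C x)"
    by (simp add: cinner_self)
  also have "\<dots> = (c * cnj c) * cinner x x"
    by (simp add: cinner_simps)
  also have "\<dots> = complex_of_real ((cmod c * norm x)\<^sup>2)"
    by (simp add: cinner_self complex_norm_square[symmetric] power_mult_distrib)
  finally have "(norm (c *\<^sub>C x))\<^sup>2 = (cmod c * norm x)\<^sup>2"
    using of_real_eq_iff by blast
  then show ?thesis by simp
qed

lemma norm_add_square:
  "(norm (x + y))\<^sup>2 = (norm x)\<^sup>2 + (norm y)\<^sup>2 + 2 * Re (cinner x (y::'a::chilbert_space))"
proof -
  have "(norm (x + y))\<^sup>2 = Re (cinner (x + y) (x + y))"
    by (simp add: cinner_self)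
  also have "\<dots> = Re (cinner x x) + Re (cinner y y) + Re (cinner x y) + Re (cinner y x)"
    by (simp add: cinner_simps)
  also have "Re (cinner y x) = Re (cinner x y)"
    by (rule Re_cinner_commute)
  finally show ?thesis
    by (simp add: cinner_self)
qed

lemma norm_diff_square:
  "(norm (x - y))\<^sup>2 = (norm x)\<^sup>2 + (norm y)\<^sup>2 - 2 * Re (cinner x (y::'a::chilbert_space))"
  using norm_add_square[of x "- y"] by (simp add: cinner_minus_right)

text \<open>Cauchy-Schwarz for the real part comes from the triangle inequality, which is part of
  the Banach space structure: expand both squares and compare.\<close>

lemma Re_cinner_le_norm: "Re (cinner x y) \<le> norm x * norm (y::'a::chilbert_space)"
proof -
  have "(norm (x + y))\<^sup>2 \<le> (norm x + norm y)\<^sup>2"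
    by (intro power_mono norm_triangle_ineq norm_ge_zero)
  then show ?thesis
    using norm_add_square[of x y] by (simp add: power2_sum)
qed

lemma cmod_cinner_le_norm: "cmod (cinner x y) \<le> norm x * norm (y::'a::chilbert_space)"
proof (cases "cinner x y = 0")
  case False
  \<comment> \<open>A phase of modulus 1 that rotates \<open>cinner x y\<close> to its modulus, so
    that the bound on real parts becomes one on moduli.\<close>
  define c where "c = cnj (cinner x y) / complex_of_real (cmod (cinner x y))"
  have "cmod c = 1"
    using False by (simp add: c_def norm_divide)
  moreover have "cinner x (c *\<^sub>C y) = cinner x y * cnj (cinner x y) / complex_of_real (cmod (cinner x y))"
    by (simp add: c_def cinner_scaleC_right mult.commute)
  then have "cinner x (c *\<^sub>C y) = complex_of_real (cmod (cinner x y))"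
    unfolding complex_norm_square[symmetric] using False by (simp add: power2_eq_square)
  ultimately show ?thesis
    using Re_cinner_le_norm[of x "c *\<^sub>C y"] by simp
qed simp

lemma bounded_linear_cinner_right: "bounded_linear (cinner (x::'a::chilbert_space))"
proof (rule bounded_linear_intro[where K = "norm x"])
  show "cinner x (t *\<^sub>R y) = t *\<^sub>R cinner x y" for t y
    by (metis cinner_scaleC_right scaleC_of_real scaleR_conv_of_real)
  show "norm (cinner x y) \<le> norm y * norm x" for y
    using cmod_cinner_le_norm[of x y] by (simp add: mult.commute)
qed (simp add: cinner_add_right)

lemma cinner_dense_eq_0:
  fixes z :: "'a::chilbert_space"
  assumes "closure D = UNIV" and "\<And>y. y \<in> D \<Longrightarrow> cinner y z = 0"
  shows "z = 0"
proof -
  have "continuous_on (closure D) (cinner z)"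
    using bounded_linear_cinner_right linear_continuous_on by blast
  moreover have "cinner z y = 0" if "y \<in> D" for y
    using assms(2)[OF that] by (subst cinner_commute) simp
  ultimately have "cinner z z = 0"
    using continuous_constant_on_closure[of D "cinner z" 0 z] assms(1) by auto
  then show ?thesis
    by (simp add: cinner_self)
qed

section \<open>Orthogonal projections\<close>

lemma orthogonal_projection_linear:
  assumes "orthogonal_projection P"
  shows "P (x + y) = P x + P y" "P (c *\<^sub>C x) = c *\<^sub>C P x" "P (x - y) = P x - P y" "P 0 = 0"
proof -
  interpret Vector_Spaces.linear scaleC scaleC P
    using assms by (simp add: orthogonal_projection_def)
  show "P (x + y) = P x + P y" "P (c *\<^sub>C x) = c *\<^sub>C P x" "P (x - y) = P x - P y" "P 0 = 0"
    by (simp_all add: add scale diff zero)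
qed

lemma orthogonal_projection_idem: "orthogonal_projection P \<Longrightarrow> P (P x) = P x"
  by (simp add: orthogonal_projection_def)

lemma orthogonal_projection_cinner: "orthogonal_projection P \<Longrightarrow> cinner (P x) y = cinner x (P y)"
  by (simp add: orthogonal_projection_def)

lemma orthogonal_projection_cinner_self:
  assumes "orthogonal_projection P"
  shows "cinner x (P x) = complex_of_real ((norm (P x))\<^sup>2)"
  by (metis assms cinner_self orthogonal_projection_cinner orthogonal_projection_idem)

lemma orthogonal_projection_Id_minus:
  assumes "orthogonal_projection P"
  shows "orthogonal_projection (\<lambda>x. x - P x)"
  unfolding orthogonal_projection_def
proof (intro conjI allI)
  show "Vector_Spaces.linear scaleC scaleC (\<lambda>x. x - P x)"
    by unfold_locales (simp_all add: orthogonal_projection_linear[OF assms]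
        complex_vector.scale_right_diff_distrib)
  show "x - P x - P (x - P x) = x - P x" for x
    by (simp add: orthogonal_projection_linear[OF assms] orthogonal_projection_idem[OF assms])
  show "cinner (x - P x) y = cinner x (y - P y)" for x y
    by (simp add: cinner_simps orthogonal_projection_cinner[OF assms])
qed

lemma orthogonal_projection_pythagoras:
  assumes "orthogonal_projection P"
  shows "(norm x)\<^sup>2 = (norm (P x))\<^sup>2 + (norm (x - P x))\<^sup>2"
proof -
  have "cinner (P x) (x - P x) = 0"
    by (simp add: orthogonal_projection_cinner[OF assms] orthogonal_projection_linear[OF assms]
        orthogonal_projection_idem[OF assms])
  then show ?thesis
    using norm_add_square[of "P x" "x - P x"] by simp
qed

lemma orthogonal_projection_norm_le:
  assumes "orthogonal_projection P"
  shows "norm (P x) \<le> norm x"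
  using orthogonal_projection_pythagoras[OF assms, of x]
  by (simp add: power2_le_imp_le)

text \<open>For \<open>y\<close> in the range of \<open>P\<close>, the vector \<open>x - P x\<close>
  is the image of \<open>x - y\<close> under the contraction \<open>1 - P\<close>, so no point of
  the range is closer to \<open>x\<close> than \<open>P x\<close>.\<close>

lemma infdist_range_orthogonal_projection:
  assumes "orthogonal_projection P"
  shows "infdist x (range P) = norm (x - P x)"
proof (rule antisym)
  show "infdist x (range P) \<le> norm (x - P x)"
    using infdist_le[of "P x" "range P" x] by (simp add: dist_norm)
  have "norm (x - P x) \<le> dist x y" if "y \<in> range P" for y
  proof -
    have "P y = y"
      using that orthogonal_projection_idem[OF assms] by auto
    then have "(x - y) - P (x - y) = x - P x"
      by (simp add: orthogonal_projection_linear[OF assms])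
    then show ?thesis
      using orthogonal_projection_norm_le[OF orthogonal_projection_Id_minus[OF assms], of "x - y"]
      by (simp only: dist_norm)
  qed
  then show "norm (x - P x) \<le> infdist x (range P)"
    by (subst infdist_notempty) (auto intro!: cINF_greatest)
qed

lemma norm_diff_projection_le_gap:
  assumes P: "orthogonal_projection P" and G: "orthogonal_projection G"
  shows "norm (G x - P (G x)) \<le> subspace_gap (range G) (range P) * norm (G x)"
proof (cases "G x = 0")
  case True
  then show ?thesis by (simp add: orthogonal_projection_linear[OF P])
next
  case False
  define c where "c = complex_of_real (1 / norm (G x))"
  define u where "u = c *\<^sub>C G x"
  have cG: "cmod c * norm (G x) = 1"
    using False by (simp add: c_def norm_divide)
  then have u: "u \<in> {u \<in> range G. norm u = 1}"
    using orthogonal_projection_linear(2)[OF G, of c x] by (auto simp: u_def) (metis rangeI)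
  \<comment> \<open>A real supremum dominates its members only over a set that is bounded above; the
    bound 1 holds because \<open>1 - P\<close> is a contraction.\<close>
  have "bdd_above ((\<lambda>u. infdist u (range P)) ` {u \<in> range G. norm u = 1})"
    using orthogonal_projection_norm_le[OF orthogonal_projection_Id_minus[OF P]]
    by (auto simp: bdd_above_def infdist_range_orthogonal_projection[OF P] intro!: exI[of _ 1])
      metis
  then have "infdist u (range P) \<le> subspace_gap (range G) (range P)"
    unfolding subspace_gap_def using u by (intro cSUP_upper) auto
  moreover have "infdist u (range P) = cmod c * norm (G x - P (G x))"
    by (simp add: infdist_range_orthogonal_projection[OF P] u_def
        orthogonal_projection_linear[OF P]
        complex_vector.scale_right_diff_distrib[symmetric])
  ultimately show ?thesis
    using False by (simp add: c_def norm_divide field_simps)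
qed

text \<open>\<open>G (1 - P)\<close> is the adjoint of \<open>(1 - P) G\<close> and inherits its
  bound. Thus the gap also controls how the \<open>1 - P\<close> part of an arbitrary vector feeds
  back into the range of \<open>G\<close>.\<close>

lemma norm_projection_adjoint_le:
  assumes P: "orthogonal_projection P" and G: "orthogonal_projection G"
    and K: "0 \<le> K" "\<And>x. norm (G x - P (G x)) \<le> K * norm (G x)"
  shows "norm (G (x - P x)) \<le> K * norm x"
proof -
  define y where "y = G (x - P x)"
  note Q = orthogonal_projection_Id_minus[OF P]
  have Gy: "G y = y"
    by (simp add: y_def orthogonal_projection_idem[OF G])
  have "cinner y y = cinner (G y) (x - P x)"
    by (simp add: y_def orthogonal_projection_cinner[OF G] orthogonal_projection_idem[OF G])
  also have "\<dots> = cinner (y - P y) x"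
    using orthogonal_projection_cinner[OF Q, of y x] Gy by simp
  finally have "(norm y)\<^sup>2 = Re (cinner (y - P y) x)"
    by (metis Re_complex_of_real cinner_self)
  also have "\<dots> \<le> norm (y - P y) * norm x"
    by (rule Re_cinner_le_norm)
  also have "\<dots> \<le> K * norm y * norm x"
    using K(2)[of y] Gy by (intro mult_right_mono) auto
  finally have "norm y * norm y \<le> (K * norm x) * norm y"
    by (simp add: power2_eq_square mult_ac)
  then show ?thesis
    using K(1) by (cases "y = 0") (simp_all add: y_def)
qed

section \<open>Spectral measures\<close>

locale spectral_operator =
  fixes A :: "'a::chilbert_space operator" and E :: "real set \<Rightarrow> 'a \<Rightarrow> 'a"
  assumes self_adjoint: "self_adjoint A" and spectral: "is_spectral_measure_of E A"
begin

abbreviation D where "D \<equiv> op_dom A"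
abbreviation F where "F \<equiv> op_fun A"
abbreviation m where "m \<equiv> scalar_spectral_measure E"

section \<open>Linearity and symmetry of the operator on its domain\<close>

lemma linear_A: "linear_operator A" and dense: "closure D = UNIV"
  using self_adjoint by (auto simp: self_adjoint_def)

lemma subspace_D: "complex_vector.subspace D"
  using linear_A by (simp add: linear_operator_def)

lemma D_add: "x \<in> D \<Longrightarrow> y \<in> D \<Longrightarrow> x + y \<in> D"
  and D_diff: "x \<in> D \<Longrightarrow> y \<in> D \<Longrightarrow> x - y \<in> D"
  and D_scale: "x \<in> D \<Longrightarrow> c *\<^sub>C x \<in> D"
  using subspace_D complex_vector.subspace_add complex_vector.subspace_diff
    complex_vector.subspace_scale by blast+

lemma F_add: "x \<in> D \<Longrightarrow> y \<in> D \<Longrightarrow> F (x + y) = F x + F y"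
  and F_scale: "x \<in> D \<Longrightarrow> F (c *\<^sub>C x) = c *\<^sub>C F x"
  using linear_A by (auto simp: linear_operator_def)

lemma F_diff: "x \<in> D \<Longrightarrow> y \<in> D \<Longrightarrow> F (x - y) = F x - F y"
  using F_add[of "x - y" y] D_diff[of x y] by simp

lemma F_symmetric:
  assumes "x \<in> D" "y \<in> D" shows "cinner x (F y) = cinner (F x) y"
proof -
  have "(x, F x) \<in> adjoint_graph A"
    using self_adjoint assms by (auto simp: self_adjoint_def op_graph_def)
  then show ?thesis
    using assms by (auto simp: adjoint_graph_def)
qed

lemma pvm: "projection_valued_measure E"
  using spectral by (simp add: is_spectral_measure_of_def)

lemma E_proj: "S \<in> sets borel \<Longrightarrow> orthogonal_projection (E S)"
  and E_UNIV: "E UNIV x = x"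
  and E_Int: "S \<in> sets borel \<Longrightarrow> S' \<in> sets borel \<Longrightarrow> E S (E S' x) = E (S \<inter> S') x"
  and E_sums: "range C \<subseteq> sets borel \<Longrightarrow> disjoint_family C \<Longrightarrow> (\<lambda>n::nat. E (C n) x) sums E (\<Union>n. C n) x"
  using pvm by (auto simp: projection_valued_measure_def)

section \<open>Scalar spectral measures and their moments\<close>

lemmas E_linear = orthogonal_projection_linear[OF E_proj]

lemma sets_m [simp]: "sets (m x) = sets borel" and space_m [simp]: "space (m x) = UNIV"
  by (simp_all add: scalar_spectral_measure_def sets.sigma_sets_eq[of borel, simplified])

lemma Re_cinner_E: "S \<in> sets borel \<Longrightarrow> Re (cinner x (E S x)) = (norm (E S x))\<^sup>2"
  by (simp add: orthogonal_projection_cinner_self[OF E_proj])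

lemma E_empty [simp]: "E {} x = 0"
proof -
  have "(\<lambda>n::nat. E {} x) sums E {} x"
    using E_sums[of "\<lambda>_. {}" x] by (simp add: disjoint_family_on_def)
  then have "(\<lambda>n::nat. E {} x) \<longlonglongrightarrow> 0"
    using sums_summable summable_LIMSEQ_zero by blast
  then show ?thesis
    by (simp add: LIMSEQ_const_iff)
qed

text \<open>\<open>measure_of\<close> returns the prescribed values only once these are known to be
  countably additive; this is strong additivity of \<open>E\<close> pushed through the bounded
  functional \<open>cinner x\<close>.\<close>

lemma emeasure_m:
  assumes "S \<in> sets borel"
  shows "emeasure (m x) S = ennreal ((norm (E S x))\<^sup>2)"
proof -
  have "emeasure (m x) S = ennreal (Re (cinner x (E S x)))"
    unfolding scalar_spectral_measure_def
  proof (rule emeasure_measure_of_sigma)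
    show "sigma_algebra UNIV (sets (borel :: real measure))"
      by (metis sets.sigma_algebra_axioms space_borel)
    show "positive (sets borel) (\<lambda>S. ennreal (Re (cinner x (E S x))))"
      by (simp add: positive_def)
    show "countably_additive (sets borel) (\<lambda>S. ennreal (Re (cinner x (E S x))))"
      unfolding countably_additive_def
    proof (intro allI impI)
      fix C :: "nat \<Rightarrow> real set"
      assume C: "range C \<subseteq> sets borel" "disjoint_family C" "\<Union> (range C) \<in> sets borel"
      have "(\<lambda>n. Re (cinner x (E (C n) x))) sums Re (cinner x (E (\<Union>n. C n) x))"
        using bounded_linear.sums[OF bounded_linear_Re
            bounded_linear.sums[OF bounded_linear_cinner_right E_sums[OF C(1,2)]]] .
      then show "(\<Sum>n. ennreal (Re (cinner x (E (C n) x)))) = ennreal (Re (cinner x (E (\<Union> (range C)) x)))"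
        using C(1) by (intro suminf_ennreal_eq) (auto simp: Re_cinner_E range_subsetD)
    qed
  qed (use assms in auto)
  then show ?thesis
    using assms by (simp add: Re_cinner_E)
qed

lemma emeasure_m_UNIV: "emeasure (m x) UNIV = ennreal ((norm x)\<^sup>2)"
  by (simp add: emeasure_m E_UNIV)

lemma finite_measure_m: "finite_measure (m x)"
  by (rule finite_measureI) (simp add: emeasure_m_UNIV)

lemma measure_m_UNIV: "measure (m x) UNIV = (norm x)\<^sup>2"
  by (simp add: measure_def emeasure_m_UNIV)

lemma borel_measurable_m [simp]:
  "(borel_measurable (m x) :: (real \<Rightarrow> 'b::topological_space) set) = borel_measurable borel"
  by (rule measurable_cong_sets) simp_all

lemma D_iff: "x \<in> D \<longleftrightarrow> (\<integral>\<^sup>+ t. ennreal (t\<^sup>2) \<partial>m x) < \<infinity>"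
  using spectral by (auto simp: is_spectral_measure_of_def)

lemma quadratic_form: "x \<in> D \<Longrightarrow> cinner x (F x) = complex_of_real (\<integral> t. t \<partial>m x)"
  using spectral by (auto simp: is_spectral_measure_of_def)

lemma integrable_id:
  assumes "x \<in> D" shows "integrable (m x) (\<lambda>t. t)"
proof -
  interpret finite_measure "m x" by (rule finite_measure_m)
  have "integrable (m x) (\<lambda>t. t\<^sup>2)"
    using assms by (intro integrableI_nonneg) (auto simp: D_iff)
  then have int: "integrable (m x) (\<lambda>t. 1 + t\<^sup>2)" by simp
  have ae: "AE t in m x. norm t \<le> norm (1 + t\<^sup>2)"
  proof (rule AE_I2)
    fix t :: real
    have "0 \<le> (\<bar>t\<bar> - 1)\<^sup>2" "0 \<le> t\<^sup>2" by simp_all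
    then show "norm t \<le> norm (1 + t\<^sup>2)" by (simp add: power2_diff)
  qed
  show ?thesis
    by (rule Bochner_Integration.integrable_bound[OF int _ ae]) simp
qed

text \<open>Multiplicativity of \<open>E\<close> turns the projection of a vector into the
  restriction of its measure. Integrals for \<open>E S x\<close> thereby become integrals over
  \<open>S\<close> for \<open>x\<close>.\<close>

lemma m_E_density:
  assumes "S \<in> sets borel"
  shows "m (E S x) = density (m x) (\<lambda>t. indicator S t)"
proof (rule measure_eqI)
  fix T assume "T \<in> sets (m (E S x))"
  then have T: "T \<in> sets borel" by simp
  have "emeasure (density (m x) (indicator S)) T = emeasure (m x) (S \<inter> T)"
    using assms T by (simp add: emeasure_density indicator_inter_arith[symmetric])
  then show "emeasure (m (E S x)) T = emeasure (density (m x) (indicator S)) T"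
    using assms T by (simp add: emeasure_m E_Int Int_commute)
qed simp

text \<open>Restricting the measure to \<open>S\<close> can only lower the second moment, whose
  finiteness characterises the domain.\<close>

lemma E_D:
  assumes "S \<in> sets borel" "x \<in> D" shows "E S x \<in> D"
proof -
  have "(\<integral>\<^sup>+ t. ennreal (t\<^sup>2) \<partial>m (E S x)) = (\<integral>\<^sup>+ t. indicator S t * ennreal (t\<^sup>2) \<partial>m x)"
    unfolding m_E_density[OF assms(1)] using assms(1) by (subst nn_integral_density) auto
  also have "\<dots> \<le> (\<integral>\<^sup>+ t. ennreal (t\<^sup>2) \<partial>m x)"
    by (rule nn_integral_mono) (auto simp: indicator_def)
  finally show ?thesis
    using assms(2) D_iff by (metis order_le_less_trans)
qed

lemma AE_m:
  assumes "S \<in> sets borel" "E S x = x" shows "AE t in m x. t \<in> S"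
proof -
  have "E (- S) x = 0"
    using E_Int[of "- S" S x] assms by simp
  then have "- S \<in> null_sets (m x)"
    using assms(1) by (auto simp: null_sets_def emeasure_m)
  then show ?thesis
    by (rule AE_I') auto
qed

text \<open>The measure of such a vector has finite mass and is concentrated on a bounded set, so
  its second moment is finite.\<close>

lemma bounded_range_D:
  assumes "S \<in> sets borel" "S \<subseteq> cball c k" shows "E S x \<in> D"
proof -
  let ?y = "E S x" and ?M = "\<bar>c\<bar> + \<bar>k\<bar>"
  have "E S ?y = ?y"
    using E_Int[of S S x] assms by simp
  then have "AE t in m ?y. t \<in> S"
    using AE_m assms(1) by blast
  then have "AE t in m ?y. ennreal (t\<^sup>2) \<le> ennreal (?M\<^sup>2)"
  proof eventually_elim
    case (elim t)
    then have "\<bar>t\<bar> \<le> ?M" using assms(2) by (auto simp: dist_real_def)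
    then show ?case by (intro ennreal_leI) (metis abs_ge_zero power2_abs power_mono)
  qed
  then have "(\<integral>\<^sup>+ t. ennreal (t\<^sup>2) \<partial>m ?y) \<le> (\<integral>\<^sup>+ t. ennreal (?M\<^sup>2) \<partial>m ?y)"
    by (rule nn_integral_mono_AE)
  also have "\<dots> < \<infinity>"
    by (simp add: emeasure_m_UNIV ennreal_mult_less_top)
  finally show ?thesis by (simp add: D_iff)
qed

lemma E_Compl: "S \<in> sets borel \<Longrightarrow> E (- S) x = x - E S x"
proof -
  assume S: "S \<in> sets borel"
  \<comment> \<open>Additivity is given for sequences only, so the pair \<open>S\<close>,
    \<open>- S\<close> is padded with empty sets.\<close>
  define C where "C n = (if n = 0 then S else if n = Suc 0 then - S else {})" for n :: nat
  have "(\<lambda>n. E (C n) x) sums E (\<Union>n. C n) x"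
    using S by (intro E_sums) (auto simp: C_def disjoint_family_on_def)
  moreover have "(\<Union>n. C n) = UNIV"
    by (auto simp: C_def split: if_splits)
  moreover have "(\<lambda>n. E (C n) x) sums (\<Sum>n<2. E (C n) x)"
    by (rule sums_finite) (auto simp: C_def)
  ultimately have "x = (\<Sum>n<2. E (C n) x)"
    by (metis E_UNIV sums_unique2)
  also have "\<dots> = E S x + E (- S) x"
    by (simp add: C_def numeral_2_eq_2)
  finally show ?thesis by (simp add: algebra_simps)
qed

section \<open>Reduction of the operator by spectral subspaces\<close>

lemma integral_split:
  assumes S: "S \<in> sets borel" and x: "x \<in> D"
  shows "(\<integral> t. t \<partial>m x) = (\<integral> t. t \<partial>m (E S x)) + (\<integral> t. t \<partial>m (E (- S) x))"
proof -
  have *: "(\<integral> t. t \<partial>m (E T x)) = (\<integral> t. indicator T t * t \<partial>m x)"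
    and **: "integrable (m x) (\<lambda>t. indicator T t * t)" if "T \<in> sets borel" for T
  proof -
    have "m (E T x) = density (m x) (\<lambda>t. ennreal (indicator T t))"
      by (simp add: m_E_density[OF that] ennreal_indicator)
    then show "(\<integral> t. t \<partial>m (E T x)) = (\<integral> t. indicator T t * t \<partial>m x)"
      using that by (simp add: integral_density)
    show "integrable (m x) (\<lambda>t. indicator T t * t)"
      by (rule Bochner_Integration.integrable_bound[OF integrable_id[OF x]])
        (use that in \<open>auto simp: indicator_def\<close>)
  qed
  have "(\<integral> t. t \<partial>m x) = (\<integral> t. indicator S t * t + indicator (- S) t * t \<partial>m x)"
    by (rule Bochner_Integration.integral_cong) (auto simp: indicator_def)
  also have "\<dots> = (\<integral> t. indicator S t * t \<partial>m x) + (\<integral> t. indicator (- S) t * t \<partial>m x)"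
    using S by (intro Bochner_Integration.integral_add **) auto
  also have "\<dots> = (\<integral> t. t \<partial>m (E S x)) + (\<integral> t. t \<partial>m (E (- S) x))"
    by (simp only: *[OF S] *[OF borel_comp[OF S]])
  finally show ?thesis .
qed

text \<open>
  The form \<open>x \<mapsto> \<langle>x, Ax\<rangle>\<close> is additive over \<open>u + cv\<close> for every \<open>c\<close>; the values \<open>c = 1\<close> and \<open>c = i\<close> kill the
  mixed terms.
\<close>

lemma cinner_F_eq_0:
  assumes S: "S \<in> sets borel" and u: "u \<in> D" "E S u = u" and v: "v \<in> D" "E S v = 0"
  shows "cinner u (F v) = 0"
proof -
  have eq: "cinner u (F (c *\<^sub>C v)) + cinner (c *\<^sub>C v) (F u) = 0" for c
  proof -
    let ?w = "c *\<^sub>C v"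
    have w: "?w \<in> D" using v D_scale by blast
    have ES: "E S (u + ?w) = u" "E (- S) (u + ?w) = ?w"
      using u v S by (simp_all add: E_Compl E_linear)
    have "cinner (u + ?w) (F (u + ?w)) = cinner u (F u) + cinner ?w (F ?w)"
      using integral_split[OF S D_add[OF u(1) w], unfolded ES]
      by (simp only: quadratic_form[OF D_add[OF u(1) w]] quadratic_form[OF u(1)]
          quadratic_form[OF w] of_real_add)
    moreover have "cinner (u + ?w) (F (u + ?w)) =
        (cinner u (F u) + cinner ?w (F ?w)) + (cinner u (F ?w) + cinner ?w (F u))"
      unfolding F_add[OF u(1) w] cinner_add_left cinner_add_right by (simp only: add_ac)
    ultimately show ?thesis
      by (metis add_cancel_right_right)
  qed
  have "cinner u (F v) + cinner v (F u) = 0"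
    using eq[of 1] by simp
  moreover have "\<i> * (cinner u (F v) - cinner v (F u)) = 0"
    using eq[of \<i>] by (simp only: F_scale[OF v(1)] cinner_scaleC_left cinner_scaleC_right)
      (simp add: algebra_simps)
  then have "cinner v (F u) = cinner u (F v)" by simp
  ultimately have "2 * cinner u (F v) = 0" by (simp only: mult_2)
  then show ?thesis by simp
qed

text \<open>The off-diagonal block \<open>E T (F (E (- T) x))\<close> is orthogonal to the dense
  domain by \<open>cinner_F_eq_0\<close>, hence zero. Taking \<open>T = S\<close> and
  \<open>T = - S\<close> removes both blocks.\<close>

lemma F_E_commute:
  assumes S: "S \<in> sets borel" and x: "x \<in> D"
  shows "F (E S x) = E S (F x)"
proof -
  have 1: "E T (F (E (- T) x)) = 0" if T: "T \<in> sets borel" for T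
  proof (rule cinner_dense_eq_0[OF dense])
    fix y assume y: "y \<in> D"
    have "cinner (E T y) (F (E (- T) x)) = 0"
      using T x y E_Int[of T T y] E_Int[of T "- T" x] by (intro cinner_F_eq_0[of T] E_D) auto
    then show "cinner y (E T (F (E (- T) x))) = 0"
      using orthogonal_projection_cinner[OF E_proj[OF T]] by metis
  qed
  have xs: "F x = F (E S x) + F (E (- S) x)"
    using F_add[of "E S x" "E (- S) x"] E_D[OF _ x, of S] E_D[OF _ x, of "- S"] S
    by (simp add: E_Compl)
  have "E S (F x) = E S (F (E S x))"
    using 1[OF S] S by (simp add: xs E_linear)
  moreover have "F (E S x) - E S (F (E S x)) = 0"
    using 1[of "- S"] S by (simp add: E_Compl)
  ultimately show ?thesis by simp
qed

section \<open>From bounds on the quadratic form to bounds on norms\<close>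

lemma form_ge:
  assumes "S \<in> sets borel" "S \<subseteq> {k..}" "x \<in> D" "E S x = x"
  shows "k * (norm x)\<^sup>2 \<le> Re (cinner x (F x))"
proof -
  interpret finite_measure "m x" by (rule finite_measure_m)
  have "(\<integral> t. k \<partial>m x) \<le> (\<integral> t. t \<partial>m x)"
    using AE_m[OF assms(1,4)] assms(2)
    by (intro integral_mono_AE integrable_id assms) auto
  then show ?thesis
    by (simp add: quadratic_form assms measure_m_UNIV mult.commute)
qed

lemma form_le:
  assumes "S \<in> sets borel" "S \<subseteq> {..k}" "x \<in> D" "E S x = x"
  shows "Re (cinner x (F x)) \<le> k * (norm x)\<^sup>2"
proof -
  interpret finite_measure "m x" by (rule finite_measure_m)
  have "(\<integral> t. t \<partial>m x) \<le> (\<integral> t. k \<partial>m x)"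
    using AE_m[OF assms(1,4)] assms(2)
    by (intro integral_mono_AE integrable_id assms) auto
  then show ?thesis
    by (simp add: quadratic_form assms measure_m_UNIV mult.commute)
qed

text \<open>
  The bounds on the form are turned into a norm bound by polarizing \<open>\<langle>x, By\<rangle>\<close> for \<open>B = A - k\<close> and \<open>x\<close> the
  multiple of \<open>By\<close> with the norm of \<open>y\<close>.
\<close>

lemma norm_le_of_form:
  assumes S: "S \<in> sets borel" "S \<subseteq> cball k \<eta>" and y: "E S y = y"
  shows "norm (F y - complex_of_real k *\<^sub>C y) \<le> \<eta> * norm y"
proof -
  define B where "B z = F z - complex_of_real k *\<^sub>C z" for z
  have D: "z \<in> D" if "E S z = z" for z
    using bounded_range_D[OF S, of z] that by simp
  have BE: "E S (B y) = B y"
    using F_E_commute[OF S(1) D[OF y]] by (simp add: B_def E_linear S y)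
  have bnd: "\<bar>Re (cinner z (B z))\<bar> \<le> \<eta> * (norm z)\<^sup>2" if "E S z = z" for z
  proof -
    have "S \<subseteq> {k - \<eta>..}" "S \<subseteq> {..k + \<eta>}"
      using S(2) by (force simp: dist_real_def)+
    from form_ge[OF S(1) this(1) D[OF that] that] form_le[OF S(1) this(2) D[OF that] that]
    show ?thesis
      by (simp add: B_def cinner_simps cinner_self algebra_simps)
  qed
  show ?thesis
  proof (cases "B y = 0")
    case True
    \<comment> \<open>No sign of \<eta> is assumed; if \<open>y\<close> is nonzero, the two-sided
      form bound forces it to be nonnegative.\<close>
    have "0 \<le> \<eta> * norm y"
    proof (cases "y = 0")
      case False
      have "0 \<le> \<eta> * (norm y)\<^sup>2" using bnd[OF y] by linarith
      then show ?thesis using False by (simp add: zero_le_mult_iff)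
    qed simp
    then show ?thesis using True by (simp add: B_def)
  next
    case False
    define x where "x = complex_of_real (norm y / norm (B y)) *\<^sub>C B y"
    have nx: "norm x = norm y"
      using False by (simp add: x_def norm_divide)
    have Ex: "E S x = x"
      by (simp add: x_def E_linear S BE)
    have Bxy: "B (x + y) = B x + B y" "B (x - y) = B x - B y"
      using D[OF Ex] D[OF y]
      by (simp_all add: B_def F_add F_diff scaleC_add_right
          complex_vector.scale_right_diff_distrib)
    have "Re (cinner y (F x)) = Re (cinner x (F y))"
      using F_symmetric[OF D[OF y] D[OF Ex]] Re_cinner_commute[of "F y" x] by simp
    then have sym: "Re (cinner y (B x)) = Re (cinner x (B y))"
      using Re_cinner_commute[of x y] by (simp add: B_def cinner_simps)
    have "4 * Re (cinner x (B y)) = Re (cinner (x + y) (B (x + y))) - Re (cinner (x - y) (B (x - y)))"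
      using sym by (simp add: Bxy cinner_simps)
    also have "\<dots> \<le> \<eta> * (norm (x + y))\<^sup>2 + \<eta> * (norm (x - y))\<^sup>2"
      using bnd[of "x + y"] bnd[of "x - y"] by (simp add: E_linear S Ex y)
    \<comment> \<open>The parallelogram law together with \<open>norm x = norm y\<close>.\<close>
    also have "\<dots> = 4 * \<eta> * (norm y)\<^sup>2"
      by (simp add: norm_add_square norm_diff_square nx algebra_simps)
    finally have "Re (cinner x (B y)) \<le> \<eta> * (norm y)\<^sup>2" by simp
    moreover have "Re (cinner x (B y)) = norm y * norm (B y)"
      using False by (simp add: x_def cinner_simps cinner_self power2_eq_square)
    ultimately have "norm y * norm (B y) \<le> norm y * (\<eta> * norm y)"
      by (simp add: power2_eq_square mult_ac)
    moreover have "norm y > 0"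
      using False linear_A D[OF y] F_diff[of y y] by (auto simp: B_def)
    ultimately show ?thesis
      by (simp add: B_def)
  qed
qed

text \<open>The part of \<open>w\<close> above \<open>c + h\<close> and the part below
  \<open>c - h\<close> are treated separately: on each, the form of \<open>A - c\<close> has a fixed
  sign and size at least \<open>h\<close>, and Cauchy-Schwarz gives the norm bound. Since
  \<open>A - c\<close> preserves the two orthogonal parts, Pythagoras joins them.\<close>

lemma norm_ge_of_gap:
  assumes w: "w \<in> D" "E {c - h..c + h} w = 0" and h: "0 \<le> h"
  shows "h * norm w \<le> norm (F w - complex_of_real c *\<^sub>C w)"
proof -
  define T where "T = {c + h<..}"
  define B where "B z = F z - complex_of_real c *\<^sub>C z" for z
  have T: "T \<in> sets borel" "- T = {..c + h}"
    by (auto simp: T_def)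
  have low: "h * norm z \<le> norm (B z)" if "h * (norm z)\<^sup>2 \<le> \<bar>Re (cinner z (B z))\<bar>" for z
  proof -
    have "\<bar>Re (cinner z (B z))\<bar> \<le> norm z * norm (B z)"
      using abs_Re_le_cmod cmod_cinner_le_norm order_trans by blast
    then have "norm z * (h * norm z) \<le> norm z * norm (B z)"
      using that by (simp add: power2_eq_square mult_ac)
    then show ?thesis by (cases "z = 0") simp_all
  qed
  let ?p = "E T w" and ?q = "E (- T) w"
  have p: "?p \<in> D" "E T ?p = ?p" and q: "?q \<in> D"
    using T w by (auto intro: E_D simp: E_Int)
  \<comment> \<open>What \<open>?q\<close> could have outside \<open>{..<c - h}\<close> lies in the
    closed gap interval, where \<open>w\<close> has no component.\<close>
  have "E (- {..<c - h}) ?q = E {c - h..c + h} w"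
    using T by (simp add: E_Int) (metis Int_atLeastAtMostL1 Int_commute Compl_lessThan atLeastAtMost_def)
  then have q': "E {..<c - h} ?q = ?q"
    using E_Compl[of "{..<c - h}" ?q] w by simp
  have "(c + h) * (norm ?p)\<^sup>2 \<le> Re (cinner ?p (F ?p))"
    by (rule form_ge[OF T(1) _ p]) (auto simp: T_def)
  then have 1: "h * norm ?p \<le> norm (B ?p)"
    by (intro low) (simp add: B_def cinner_simps cinner_self algebra_simps)
  have "Re (cinner ?q (F ?q)) \<le> (c - h) * (norm ?q)\<^sup>2"
    by (rule form_le[OF _ _ q q']) auto
  then have 2: "h * norm ?q \<le> norm (B ?q)"
    by (intro low) (simp add: B_def cinner_simps cinner_self algebra_simps)
  have Bp: "B ?p = E T (B w)"
    using F_E_commute[OF T(1) w(1)] by (simp add: B_def E_linear T)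
  have "B ?q = B w - B ?p"
    using F_diff[OF w(1) p(1)] E_Compl[OF T(1), of w]
    by (simp add: B_def complex_vector.scale_right_diff_distrib)
  then have Bq: "B ?q = B w - E T (B w)"
    by (simp only: Bp)
  have "(h * norm w)\<^sup>2 = (h * norm ?p)\<^sup>2 + (h * norm ?q)\<^sup>2"
    by (simp only: orthogonal_projection_pythagoras[OF E_proj[OF T(1)], of w]
        E_Compl[OF T(1)] power_mult_distrib distrib_left)
  also have "\<dots> \<le> (norm (B ?p))\<^sup>2 + (norm (B ?q))\<^sup>2"
    using 1 2 h by (intro add_mono power_mono) auto
  also have "\<dots> = (norm (B w))\<^sup>2"
    using orthogonal_projection_pythagoras[OF E_proj[OF T(1)], of "B w"] by (simp add: Bp Bq)
  finally show ?thesis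
    unfolding B_def by (rule power2_le_imp_le) simp
qed

section \<open>The spectral measure vanishes on the resolvent set\<close>

lemma E_locally_null:
  assumes "complex_of_real t \<in> resolvent_set A"
  shows "\<exists>\<eta>>0. \<forall>S\<in>sets borel. S \<subseteq> ball t \<eta> \<longrightarrow> (\<forall>x. E S x = 0)"
proof -
  obtain C where C: "\<And>x. x \<in> D \<Longrightarrow> norm x \<le> C * norm (F x - complex_of_real t *\<^sub>C x)"
    using assms by (auto simp: resolvent_set_def)
  \<comment> \<open>Chosen so that \<open>\<bar>C\<bar> * \<eta> \<le> 1/2\<close>: the resolvent
    bound and \<open>norm_le_of_form\<close> then give \<open>norm ?y \<le> norm ?y / 2\<close>.
    Adding 1 avoids division by zero.\<close>
  define \<eta> where "\<eta> = 1 / (2 * (\<bar>C\<bar> + 1))"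
  have "E S x = 0" if S: "S \<in> sets borel" "S \<subseteq> ball t \<eta>" for S x
  proof -
    let ?y = "E S x"
    have S': "S \<subseteq> cball t \<eta>" using S(2) ball_subset_cball by blast
    have y: "E S ?y = ?y" using E_Int[OF S(1) S(1)] by simp
    have "norm ?y \<le> C * norm (F ?y - complex_of_real t *\<^sub>C ?y)"
      using bounded_range_D[OF S(1) S'] by (rule C)
    also have "\<dots> \<le> \<bar>C\<bar> * (\<eta> * norm ?y)"
      using norm_le_of_form[OF S(1) S' y] by (intro mult_mono) auto
    also have "\<dots> = (\<bar>C\<bar> * \<eta>) * norm ?y" by simp
    also have "\<dots> \<le> (1/2) * norm ?y"
      by (intro mult_right_mono) (auto simp: \<eta>_def field_simps)
    finally show ?thesis by simp
  qed
  moreover have "\<eta> > 0" by (simp add: \<eta>_def)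
  ultimately show ?thesis by blast
qed

text \<open>Local vanishing extends to arbitrary Borel sets by the Lindelof property: countably many
  null open sets cover \<open>J\<close>, and a countable union of null sets is null.\<close>

lemma E_null:
  assumes J: "J \<in> sets borel" "complex_of_real ` J \<subseteq> resolvent_set A"
  shows "E J x = 0"
proof -
  define U where "U = {S. open S \<and> (\<forall>x. E S x = 0)}"
  obtain U' where U': "U' \<subseteq> U" "countable U'" "\<Union>U' = \<Union>U"
    using Lindelof[of U] by (auto simp: U_def)
  have "(\<Union>S\<in>U'. S) \<in> null_sets (m x)"
  proof (rule null_sets_UN'[OF U'(2)])
    fix S assume "S \<in> U'"
    then have "open S" "E S x = 0" using U'(1) by (auto simp: U_def)
    then show "S \<in> null_sets (m x)" by (auto simp: null_sets_def emeasure_m)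
  qed
  moreover have "J \<subseteq> \<Union>U'"
  proof
    fix t assume "t \<in> J"
    then obtain \<eta> where "\<eta> > 0" "\<forall>S\<in>sets borel. S \<subseteq> ball t \<eta> \<longrightarrow> (\<forall>x. E S x = 0)"
      using E_locally_null J(2) by blast
    then have "ball t \<eta> \<in> U" "t \<in> ball t \<eta>" by (auto simp: U_def)
    then show "t \<in> \<Union>U'" using U'(3) by blast
  qed
  ultimately have "J \<in> null_sets (m x)"
    using J(1) null_sets_subset[of "\<Union>U'" "m x" J] by simp
  then show ?thesis
    using J(1) by (simp add: null_sets_def emeasure_m)
qed

text \<open>A singleton is a ball of radius 0, so \<open>norm_le_of_form\<close> leaves no
  error.\<close>

lemma E_singleton_eigenvector:
  "E {l} x \<in> D" "F (E {l} x) = complex_of_real l *\<^sub>C E {l} x"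
proof -
  show "E {l} x \<in> D"
    using bounded_range_D[of "{l}" l 0] by simp
  have "norm (F (E {l} x) - complex_of_real l *\<^sub>C E {l} x) \<le> 0 * norm (E {l} x)"
    using E_Int[of "{l}" "{l}" x] by (intro norm_le_of_form) auto
  then show "F (E {l} x) = complex_of_real l *\<^sub>C E {l} x" by simp
qed

text \<open>On the range of \<open>E {l}\<close> the operator \<open>A - \<nu>\<close> is the scalar
  \<open>l - \<nu>\<close>. On the complement \<open>A - l\<close> is bounded below by
  \<open>2 * r\<close>, and moving from \<open>l\<close> to \<nu> costs at most \<open>r\<close>;
  what remains is at least \<open>cmod (l - \<nu>)\<close>. This is why the isolation radius is
  twice the distance allowed for \<nu>.\<close>

lemma norm_ge_of_isolated:
  assumes v: "v \<in> D" and iso: "\<And>x. E ({l - 2 * r..l + 2 * r} - {l}) x = 0"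
    and \<nu>: "cmod (complex_of_real l - \<nu>) \<le> r"
  shows "cmod (complex_of_real l - \<nu>) * norm v \<le> norm (F v - \<nu> *\<^sub>C v)"
proof -
  let ?d = "cmod (complex_of_real l - \<nu>)" and ?p = "E {l} v" and ?q = "E (- {l}) v"
  define B where "B z = F z - \<nu> *\<^sub>C z" for z
  have r: "0 \<le> r" using \<nu> norm_ge_zero order_trans by blast
  have D: "?p \<in> D" "?q \<in> D" using v by (auto intro: E_D)
  have "B ?p = (complex_of_real l - \<nu>) *\<^sub>C ?p"
    by (simp add: B_def E_singleton_eigenvector complex_vector.scale_left_diff_distrib)
  then have 1: "norm (B ?p) = ?d * norm ?p" by simp
  have "{l - 2 * r..l + 2 * r} \<inter> - {l} = {l - 2 * r..l + 2 * r} - {l}" by blast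
  then have "E {l - 2 * r..l + 2 * r} ?q = 0"
    using iso by (simp add: E_Int)
  then have "2 * r * norm ?q \<le> norm (F ?q - complex_of_real l *\<^sub>C ?q)"
    using D r by (intro norm_ge_of_gap) auto
  also have "F ?q - complex_of_real l *\<^sub>C ?q = B ?q - (complex_of_real l - \<nu>) *\<^sub>C ?q"
    by (simp add: B_def complex_vector.scale_left_diff_distrib)
  also have "norm \<dots> \<le> norm (B ?q) + ?d * norm ?q"
    using norm_triangle_ineq4[of "B ?q" "(complex_of_real l - \<nu>) *\<^sub>C ?q"] by simp
  also have "\<dots> \<le> norm (B ?q) + r * norm ?q"
    using \<nu> by (simp add: mult_right_mono)
  finally have "r * norm ?q \<le> norm (B ?q)" by simp
  moreover have "?d * norm ?q \<le> r * norm ?q"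
    using \<nu> by (simp add: mult_right_mono)
  ultimately have 2: "?d * norm ?q \<le> norm (B ?q)" by linarith
  have Bp: "B ?p = E {l} (B v)"
    using F_E_commute[OF _ v, of "{l}"] by (simp add: B_def E_linear)
  have "B ?q = B v - B ?p"
    using F_diff[OF v D(1)] E_Compl[of "{l}" v]
    by (simp add: B_def complex_vector.scale_right_diff_distrib)
  then have Bq: "B ?q = B v - E {l} (B v)"
    by (simp only: Bp)
  have "(?d * norm v)\<^sup>2 = (?d * norm ?p)\<^sup>2 + (?d * norm ?q)\<^sup>2"
    using orthogonal_projection_pythagoras[OF E_proj[of "{l}"], of v] E_Compl[of "{l}" v]
    by (simp add: power_mult_distrib distrib_left)
  also have "\<dots> \<le> (norm (B ?p))\<^sup>2 + (norm (B ?q))\<^sup>2"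
    using 1 2 by (intro add_mono power_mono) auto
  also have "\<dots> = (norm (B v))\<^sup>2"
    using orthogonal_projection_pythagoras[OF E_proj[of "{l}"], of "B v"] by (simp add: Bp Bq)
  finally show ?thesis
    unfolding B_def by (rule power2_le_imp_le) simp
qed

end

section \<open>The eigenvalue estimate\<close>

text \<open>In the application \<open>w = (1 - G) u\<close>, \<open>p = (1 - G) P w\<close>,
  \<open>s = (A - c) w\<close>, and \<open>g\<close> is the coupling to \<open>G u\<close>. Reality
  of \<open>cinner w s\<close> determines \<open>t\<close> up to an error from \<open>g\<close>,
  which gives an upper bound for \<open>norm (s - g)\<close> to be compared with
  \<open>h * norm w \<le> norm s\<close>. With \<open>c\<close> the midpoint and \<open>h\<close>
  the half length, \<open>(Re z - a) * (Re z - b) = (Re z - c)\<^sup>2 - h\<^sup>2\<close>, so the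
  hypothesis on \<open>z\<close> says that the function defining the curve is at most
  \<open>- \<delta>\<close>.\<close>

lemma compressed_resolvent_bound:
  fixes w p g s :: "'a::chilbert_space"
  assumes s: "s = (z - complex_of_real c) *\<^sub>C w - \<i> *\<^sub>C p + g"
    and p: "cinner w p = complex_of_real t" "(norm p)\<^sup>2 \<le> t"
    and ws: "Im (cinner w s) = 0" and h: "0 \<le> h" "h * norm w \<le> norm s"
    and z: "(Re z - c)\<^sup>2 + Im z * (1 - Im z) \<le> h\<^sup>2 - \<delta>" "\<bar>1 - 2 * Im z\<bar> \<le> 2"
  shows "\<delta> * norm w \<le> (2 * h + 2) * norm g"
proof -
  define q N \<gamma> e where "q = (z - complex_of_real c) *\<^sub>C w - \<i> *\<^sub>C p" and "N = norm w"
    and "\<gamma> = norm g" and "e = Im (cinner w g)"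
  have N: "0 \<le> N" "0 \<le> \<gamma>" by (simp_all add: N_def \<gamma>_def)
  have t: "t = Im z * N\<^sup>2 + e"
    using ws by (simp add: s cinner_simps cinner_self p N_def e_def)
  have e: "\<bar>e\<bar> \<le> N * \<gamma>"
    unfolding e_def N_def \<gamma>_def using abs_Im_le_cmod cmod_cinner_le_norm order_trans by blast
  have e2: "(1 - 2 * Im z) * e \<le> 2 * (N * \<gamma>)"
  proof -
    have "(1 - 2 * Im z) * e \<le> \<bar>1 - 2 * Im z\<bar> * \<bar>e\<bar>"
      by (metis abs_ge_self abs_mult)
    also have "\<dots> \<le> 2 * (N * \<gamma>)"
      using z(2) e by (intro mult_mono) auto
    finally show ?thesis .
  qed
  have "(norm q)\<^sup>2 = ((Re z - c)\<^sup>2 + (Im z)\<^sup>2) * N\<^sup>2 + (norm p)\<^sup>2 - 2 * (Im z * t)"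
    by (simp add: q_def norm_diff_square cinner_simps p power_mult_distrib cmod_power2 N_def)
  also have "\<dots> \<le> ((Re z - c)\<^sup>2 + (Im z)\<^sup>2) * N\<^sup>2 + t - 2 * (Im z * t)"
    using p by simp
  \<comment> \<open>Eliminating \<open>t\<close> turns the coefficient \<open>(Im z)\<^sup>2\<close>
    into \<open>Im z * (1 - Im z)\<close>.\<close>
  also have "\<dots> = ((Re z - c)\<^sup>2 + Im z * (1 - Im z)) * N\<^sup>2 + (1 - 2 * Im z) * e"
    by (simp add: t algebra_simps power2_eq_square)
  also have "\<dots> \<le> (h\<^sup>2 - \<delta>) * N\<^sup>2 + 2 * (N * \<gamma>)"
    using z(1) e2 by (intro add_mono mult_right_mono) auto
  finally have q: "(norm q)\<^sup>2 \<le> (h\<^sup>2 - \<delta>) * N\<^sup>2 + 2 * (N * \<gamma>)" .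
  have "s = q + g" by (simp add: s q_def)
  then have hq: "h * N - \<gamma> \<le> norm q"
    using h(2) norm_triangle_ineq[of q g] by (simp add: N_def \<gamma>_def)
  have "\<delta> * N\<^sup>2 \<le> 2 * h * N * \<gamma> + 2 * (N * \<gamma>)"
  \<comment> \<open>The lower bound \<open>h * N - \<gamma>\<close> for \<open>norm q\<close> may be
    squared only if it is nonnegative. Otherwise \<open>h * N\<close> is itself below \<gamma>, and
    \<open>0 \<le> (norm q)\<^sup>2\<close> suffices.\<close>
  proof (cases "\<gamma> \<le> h * N")
    case True
    then have "(h * N - \<gamma>)\<^sup>2 \<le> (norm q)\<^sup>2"
      using hq by (intro power_mono) auto
    moreover have "(h * N - \<gamma>)\<^sup>2 \<ge> h\<^sup>2 * N\<^sup>2 - 2 * h * N * \<gamma>"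
      by (simp add: power2_diff power_mult_distrib)
    ultimately show ?thesis
      using q by (simp add: algebra_simps)
  next
    case False
    then have "(h * N) * (h * N) \<le> (h * N) * \<gamma>"
      using h N by (intro mult_left_mono) auto
    moreover have "0 \<le> norm q * norm q" "0 \<le> (h * N) * \<gamma>" using h N by auto
    ultimately have "\<delta> * (N * N) \<le> 2 * ((h * N) * \<gamma>) + 2 * (N * \<gamma>)"
      using q unfolding power2_eq_square by (simp only: algebra_simps)
    then show ?thesis
      by (simp add: algebra_simps power2_eq_square)
  qed
  then have "N * (\<delta> * N) \<le> N * ((2 * h + 2) * \<gamma>)"
    by (simp add: algebra_simps power2_eq_square)
  then show ?thesis
    unfolding N_def \<gamma>_def by (cases "w = 0") (use h in auto)
qed

text \<open>The constant depends on \<open>P\<close> only through \<open>K\<close>, which makes the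
  estimate uniform along the sequence. Its summand 1 comes from \<open>G (1 - P) v\<close>, the
  other from \<open>G (1 - P) w\<close>, where \<open>b - a + 2\<close> is
  \<open>2 * h + 2\<close>.\<close>

lemma (in spectral_operator) eigenvalue_estimate:
  assumes P: "orthogonal_projection P" and ab: "a < b"
    and K: "0 \<le> K" "\<And>x. norm (E {a..b} x - P (E {a..b} x)) \<le> K * norm (E {a..b} x)"
    and iso: "\<And>x. E ({l - 2 * r..l + 2 * r} - {l}) x = 0"
    and \<mu>: "cmod (complex_of_real l + \<i> - \<mu>) \<le> r" "\<bar>1 - 2 * Im \<mu>\<bar> \<le> 2"
    and \<delta>: "\<delta> > 0" "(Re \<mu> - a) * (Re \<mu> - b) + Im \<mu> * (1 - Im \<mu>) \<le> - \<delta>"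
    and u: "u \<in> D" "u \<noteq> 0" "F u + \<i> *\<^sub>C P u = \<mu> *\<^sub>C u"
  shows "cmod (complex_of_real l + \<i> - \<mu>) \<le> (1 + (b - a + 2) / \<delta>) * K\<^sup>2"
proof -
  define G where "G = E {a..b}"
  define v w where "v = G u" and "w = u - v"
  define c h where "c = (a + b) / 2" and "h = (b - a) / 2"
  \<comment> \<open>Writing \<open>P = 1 - (1 - P)\<close> in the \<open>G\<close> component moves
    the summand \<i> to the eigenvalue.\<close>
  define \<nu> where "\<nu> = \<mu> - \<i>"
  have Gp: "orthogonal_projection G" by (simp add: G_def E_proj)
  note Gl = orthogonal_projection_linear[OF Gp] and Gi = orthogonal_projection_idem[OF Gp]
  note Pl = orthogonal_projection_linear[OF P]
  note Rp = orthogonal_projection_Id_minus[OF Gp]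
  have v: "v \<in> D" "G v = v" and w: "w \<in> D" "G w = 0" and uvw: "u = v + w"
    using u E_D[of "{a..b}" u] by (auto simp: v_def w_def G_def[symmetric] Gi Gl D_diff)
  have com: "F (G x) = G (F x)" if "x \<in> D" for x
    using F_E_commute that by (simp add: G_def)
  have Fv: "F v = G (F u)"
    using com[OF u(1)] by (simp add: v_def)
  have "F w = F u - F v"
    using F_add[OF v(1) w(1), folded uvw] by simp
  then have Fw: "F w = F u - G (F u)"
    by (simp only: Fv)
  have Fu: "F u = \<mu> *\<^sub>C u - \<i> *\<^sub>C P u"
    using u(3) by (simp add: algebra_simps)
  define p where "p = P w - G (P w)"
  define g where "g = - (\<i> *\<^sub>C (P v - G (P v)))"
  have Fw': "F w = \<mu> *\<^sub>C w - \<i> *\<^sub>C p + g"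
    unfolding Fw Fu
    by (simp add: Gl p_def g_def uvw Pl v w scaleC_add_right
        complex_vector.scale_right_diff_distrib algebra_simps)
  have gQ: "norm g \<le> norm (v - P v)"
  proof -
    have "P v - G (P v) = - ((v - P v) - G (v - P v))" by (simp add: Gl v)
    then have "norm g = norm ((v - P v) - G (v - P v))"
      by (simp only: g_def norm_minus_cancel norm_scaleC norm_ii mult_1)
    then show ?thesis
      using orthogonal_projection_norm_le[OF Rp, of "v - P v"] by simp
  qed
  have Kv: "norm (v - P v) \<le> K * norm v"
    using K(2)[of u] by (simp add: v_def G_def)
  have wp: "cinner w p = complex_of_real ((norm (P w))\<^sup>2)"
    using orthogonal_projection_cinner[OF Gp, of w "P w"] w
    by (simp add: p_def cinner_simps orthogonal_projection_cinner_self[OF P])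
  have cw: "\<delta> * norm w \<le> (2 * h + 2) * norm g"
  proof (rule compressed_resolvent_bound[where s = "F w - complex_of_real c *\<^sub>C w"
        and z = \<mu> and p = p and t = "(norm (P w))\<^sup>2" and c = c])
    show "F w - complex_of_real c *\<^sub>C w = (\<mu> - complex_of_real c) *\<^sub>C w - \<i> *\<^sub>C p + g"
      by (simp add: Fw' complex_vector.scale_left_diff_distrib)
    show "(norm p)\<^sup>2 \<le> (norm (P w))\<^sup>2"
      unfolding p_def using orthogonal_projection_norm_le[OF Rp] by (intro power_mono) auto
    have "cinner w (F w) = cnj (cinner w (F w))"
      by (subst (2) F_symmetric[OF w(1) w(1)]) (rule cinner_commute)
    then have "Im (cinner w (F w)) = - Im (cinner w (F w))"
      by (metis cnj.sel(2))
    then have "Im (cinner w (F w)) = 0" by simp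
    then show "Im (cinner w (F w - complex_of_real c *\<^sub>C w)) = 0"
      by (simp add: cinner_simps cinner_self)
    have "{c - h..c + h} = {a..b}" by (auto simp: c_def h_def field_simps)
    then show "h * norm w \<le> norm (F w - complex_of_real c *\<^sub>C w)"
      using w ab by (intro norm_ge_of_gap) (auto simp: G_def h_def)
    show "(Re \<mu> - c)\<^sup>2 + Im \<mu> * (1 - Im \<mu>) \<le> h\<^sup>2 - \<delta>"
      using \<delta>(2) by (simp add: c_def h_def power2_eq_square field_simps)
  qed (use ab wp \<mu>(2) in \<open>auto simp: h_def\<close>)
  have w_le: "norm w \<le> (b - a + 2) / \<delta> * (K * norm v)"
  proof -
    have "2 * h + 2 = b - a + 2" by (simp add: h_def)
    then have "\<delta> * norm w \<le> (b - a + 2) * norm g" using cw by simp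
    also have "\<dots> \<le> (b - a + 2) * (K * norm v)"
      using order_trans[OF gQ Kv] ab by (intro mult_left_mono) auto
    finally have "\<delta> * norm w \<le> (b - a + 2) * (K * norm v)" .
    then show ?thesis using \<delta>(1) by (simp add: field_simps)
  qed
  have "G (P u) = v - G (u - P u)"
    by (simp add: Gl v_def)
  then have "F v - \<nu> *\<^sub>C v = \<i> *\<^sub>C G (u - P u)"
    unfolding Fv Fu \<nu>_def
    by (simp add: Gl v_def[symmetric] complex_vector.scale_left_diff_distrib
        complex_vector.scale_right_diff_distrib)
  then have "norm (F v - \<nu> *\<^sub>C v) = norm (G (u - P u))" by simp
  also have "u - P u = (v - P v) + (w - P w)"
    by (simp add: uvw Pl)
  also have "norm (G \<dots>) \<le> norm (G (v - P v)) + norm (G (w - P w))"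
    unfolding Gl(1) by (rule norm_triangle_ineq)
  also have "\<dots> \<le> K * norm (v - P v) + K * norm w"
  proof -
    have *: "norm (G (x - P x)) \<le> K * norm x" for x
      using norm_projection_adjoint_le[OF P Gp K(1)] K(2) by (simp add: G_def)
    \<comment> \<open>Idempotence of \<open>1 - P\<close> allows the adjoint bound to be applied to
      \<open>v - P v\<close> in place of \<open>v\<close>; \<open>Kv\<close> then supplies the
      second factor \<open>K\<close>.\<close>
    have "norm (G (v - P v)) \<le> K * norm (v - P v)"
      using *[of "v - P v"] by (simp add: Pl orthogonal_projection_idem[OF P])
    then show ?thesis using *[of w] by simp
  qed
  also have "\<dots> \<le> K * (K * norm v) + K * ((b - a + 2) / \<delta> * (K * norm v))"
    using Kv w_le K(1) by (intro add_mono mult_left_mono) auto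
  also have "\<dots> = (1 + (b - a + 2) / \<delta>) * K\<^sup>2 * norm v"
    by (simp add: power2_eq_square algebra_simps)
  finally have up: "norm (F v - \<nu> *\<^sub>C v) \<le> (1 + (b - a + 2) / \<delta>) * K\<^sup>2 * norm v" .
  have d: "cmod (complex_of_real l + \<i> - \<mu>) = cmod (complex_of_real l - \<nu>)"
    by (simp add: \<nu>_def algebra_simps)
  have "cmod (complex_of_real l - \<nu>) * norm v \<le> norm (F v - \<nu> *\<^sub>C v)"
    using v(1) iso \<mu>(1) unfolding d by (rule norm_ge_of_isolated)
  with up have "cmod (complex_of_real l - \<nu>) * norm v \<le> (1 + (b - a + 2) / \<delta>) * K\<^sup>2 * norm v"
    by simp
  \<comment> \<open>If \<open>v\<close> vanished, \<open>w_le\<close> would make \<open>w\<close>,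
    and hence \<open>u\<close>, vanish too.\<close>
  moreover have "norm v > 0"
    using w_le u(2) uvw by (cases "v = 0") auto
  ultimately show ?thesis
    unfolding d by simp
qed

section \<open>The curve as a zero set, and the side on which the disc lies\<close>

lemma Gamma_curve_memI:
  assumes x: "Re z \<in> {a..b}" and z: "(Re z - a) * (Re z - b) + Im z * (1 - Im z) = 0"
  shows "z \<in> Gamma_curve a b"
proof -
  let ?x = "Re z" and ?y = "Im z"
  have pm: "\<exists>s\<in>{1, -1}. q = s * sqrt (q\<^sup>2)" for q :: real
    by (cases "q \<ge> 0") auto
  show ?thesis
  \<comment> \<open>The equation is solved by completing the square in \<open>Im z\<close> for the
    first form of the curve and in \<open>Re z\<close> for the second; \<open>pm\<close> selects the
    branch of the root.\<close>
  proof (cases "b - a \<le> 1")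
    case True
    obtain s where s: "s \<in> {1, -1::real}" "?y - 1/2 = s * sqrt ((?y - 1/2)\<^sup>2)"
      using pm by blast
    have "(?y - 1/2)\<^sup>2 = 1/4 + (?x - a) * (?x - b)"
      using z by (simp add: power2_eq_square field_simps)
    with s have "z = Complex ?x (1/2 + s * sqrt (1/4 + (?x - a) * (?x - b)))"
      by (simp add: complex_eq_iff)
    then show ?thesis
      using True x s(1) unfolding Gamma_curve_def by auto
  next
    case False
    obtain s where s: "s \<in> {1, -1::real}" "?x - (a + b)/2 = s * sqrt ((?x - (a + b)/2)\<^sup>2)"
      using pm by blast
    have "(?x - (a + b)/2)\<^sup>2 = ((b - a)/2)\<^sup>2 + ?y * (?y - 1)"
      using z by (simp add: power2_eq_square field_simps)
    with s have *: "z = Complex ((a + b)/2 + s * sqrt (((b - a)/2)\<^sup>2 + ?y * (?y - 1))) ?y"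
      by (simp add: complex_eq_iff)
    have "(?x - a) * (?x - b) \<le> 0"
      using x by (auto intro: mult_nonneg_nonpos)
    then have "0 \<le> ?y * (1 - ?y)" using z by linarith
    then have "?y \<in> {0..1}" by (auto simp: zero_le_mult_iff)
    then show ?thesis
      using False * s(1) unfolding Gamma_curve_def by auto
  qed
qed

text \<open>At the centre \<open>f\<close> equals \<open>(l - a) * (l - b)\<close>, which is
  negative. It has no zero on the connected disc, so it stays negative, and compactness makes this
  uniform.\<close>

lemma cball_inside_Gamma_curve:
  assumes l: "a < l" "l < b" and disj: "cball (complex_of_real l + \<i>) \<rho> \<inter> Gamma_curve a b = {}"
    and "0 \<le> \<rho>"
  shows "\<exists>\<delta>>0. \<forall>z\<in>cball (complex_of_real l + \<i>) \<rho>.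
    (Re z - a) * (Re z - b) + Im z * (1 - Im z) \<le> - \<delta>"
proof -
  let ?B = "cball (complex_of_real l + \<i>) \<rho>"
  define f where "f z = (Re z - a) * (Re z - b) + Im z * (1 - Im z)" for z
  have cont: "continuous_on ?B f"
    unfolding f_def by (intro continuous_intros)
  \<comment> \<open>The points \<open>a + \<i>\<close> and \<open>b + \<i>\<close> lie on the curve,
    so the disc cannot reach the lines over \<open>a\<close> and \<open>b\<close>. Every zero of
    \<open>f\<close> in the disc would then lie on the curve.\<close>
  have endpoint: "\<rho> < \<bar>t - l\<bar>" if "t \<in> {a, b}" for t
  proof (rule ccontr)
    assume "\<not> \<rho> < \<bar>t - l\<bar>"
    then have "Complex t 1 \<in> ?B"
      by (auto simp: dist_norm cmod_def power2_eq_square abs_minus_commute)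
    moreover have "Complex t 1 \<in> Gamma_curve a b"
      using that l by (intro Gamma_curve_memI) auto
    ultimately show False using disj by blast
  qed
  have "f z \<noteq> 0" if z: "z \<in> ?B" for z
  proof
    assume "f z = 0"
    have "\<bar>Re z - l\<bar> \<le> \<rho>"
      using z abs_Re_le_cmod[of "complex_of_real l + \<i> - z"]
      by (simp add: dist_norm abs_minus_commute)
    then have "Re z \<in> {a..b}"
      using endpoint[of a] endpoint[of b] l by auto
    then show False
      using Gamma_curve_memI[of z a b] \<open>f z = 0\<close> z disj by (auto simp: f_def)
  qed
  then have nz: "0 \<notin> f ` ?B" by auto
  have l_in: "complex_of_real l + \<i> \<in> ?B" using assms by simp
  have f_l: "f (complex_of_real l + \<i>) < 0"
    using l by (simp add: f_def mult_pos_neg)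
  have neg: "f z < 0" if "z \<in> ?B" for z
  proof (rule ccontr)
    assume "\<not> f z < 0"
    moreover have "connected (f ` ?B)"
      using cont by (intro connected_continuous_image) auto
    ultimately have "0 \<in> f ` ?B"
      using f_l l_in that connectedD_interval[of "f ` ?B" "f (complex_of_real l + \<i>)" "f z" 0]
      by auto
    then show False using nz by blast
  qed
  obtain z0 where z0: "z0 \<in> ?B" "\<forall>z\<in>?B. f z \<le> f z0"
    using continuous_attains_sup[of ?B f] cont l_in by auto
  then show ?thesis
    using neg[of z0] by (intro exI[of _ "- f z0"]) (auto simp: f_def)
qed

text \<open>Finite dimension of the ambient \<open>S\<close> matters because \<open>dim\<close>
  takes the value 0 on infinite-dimensional spaces.\<close>

lemma complex_dim_pos:
  assumes "finite_cdim S" "V \<subseteq> S" "x \<in> V" "x \<noteq> 0"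
  shows "0 < complex_vector.dim V"
proof -
  obtain C where C: "finite C" "S \<subseteq> complex_vector.span C"
    using assms(1) by (auto simp: finite_cdim_def)
  obtain B where B: "B \<subseteq> V" "complex_vector.independent B" "V \<subseteq> complex_vector.span B"
    "card B = complex_vector.dim V"
    using complex_vector.basis_exists by blast
  have "finite B"
    using complex_vector.independent_span_bound[OF C(1) B(2)] B(1) assms(2) C(2) by blast
  moreover have "B \<noteq> {}"
    using B(3) assms(3,4) by auto
  ultimately show ?thesis
    using B(4) by (metis card_gt_0_iff)
qed

theorem theorem4p6:
  fixes A :: "'a::chilbert_space operator"
    and E :: "real set \<Rightarrow> 'a \<Rightarrow> 'a"
    and a b lam r :: real
    and L :: "real set"
    and \<kappa> :: nat
    and P :: "nat \<Rightarrow> 'a \<Rightarrow> 'a"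
    and \<epsilon> :: "nat \<Rightarrow> real"
    and \<mu> :: "nat \<Rightarrow> nat \<Rightarrow> complex"
  assumes "self_adjoint A" and "semibounded_below A" and "is_spectral_measure_of E A"
    and "a < b"
    and "complex_of_real a \<in> resolvent_set A" and "complex_of_real b \<in> resolvent_set A"
    and "finite L"
    and "spectrum A \<inter> complex_of_real ` {a..b} = complex_of_real ` L"
    and "complex_of_real ` L \<subseteq> discrete_spectrum A"
    and "lam \<in> L"
    and "\<kappa> = complex_vector.dim (range (E {lam}))"
    and "0 < r" and "r < 1/2"
    and "cball (complex_of_real lam + \<i>) (2 * r) \<inter> (\<lambda>z. z + \<i>) ` spectrum A
           = {complex_of_real lam + \<i>}"
    and "cball (complex_of_real lam + \<i>) (2 * r) \<inter> Gamma_curve a b = {}"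
    and "\<And>n. orthogonal_projection (P n)"
    and "\<And>x. (\<lambda>n. P n x) \<longlonglongrightarrow> x"
    and "\<And>n. \<epsilon> n = subspace_gap (range (E {a..b})) (range (P n))"
    and "\<forall>\<^sub>F n in sequentially. repeated_eigenvalues_in (add_i_times A (P n))
           (ball (complex_of_real lam + \<i>) r) \<kappa> (\<mu> n)"
  shows "(\<lambda>n. Max ((\<lambda>j. cmod (complex_of_real lam + \<i> - \<mu> n j)) ` {1..\<kappa>}))
           \<in> O(\<lambda>n. (\<epsilon> n)\<^sup>2)"
proof -
  interpret spectral_operator A E
    using assms by unfold_locales
  have lamD: "complex_of_real lam \<in> discrete_spectrum A"
    using assms(9,10) by blast
  have "complex_of_real lam \<in> spectrum A \<inter> complex_of_real ` {a..b}"
    using assms(8,10) by blast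
  then have "complex_of_real lam \<in> spectrum A" "lam \<in> {a..b}" by auto
  then have lam: "a < lam" "lam < b"
    using assms(5,6) by (auto simp: spectrum_def less_le)
  have iso: "E ({lam - 2 * r..lam + 2 * r} - {lam}) x = 0" for x
  proof (rule E_null)
    show "complex_of_real ` ({lam - 2 * r..lam + 2 * r} - {lam}) \<subseteq> resolvent_set A"
    proof (rule ccontr)
      assume "\<not> ?thesis"
      then obtain t where t: "t \<in> {lam - 2 * r..lam + 2 * r}" "t \<noteq> lam"
        "complex_of_real t \<in> spectrum A"
        unfolding spectrum_def by blast
      have "complex_of_real t + \<i> \<in> cball (complex_of_real lam + \<i>) (2 * r)"
        using t(1) by (auto simp: dist_norm simp flip: of_real_diff)
      then have "complex_of_real t + \<i> = complex_of_real lam + \<i>"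
        using t(3) assms(14) by blast
      then show False using t(2) by simp
    qed
  qed simp
  \<comment> \<open>Ensures that the maximum is taken over a nonempty set.\<close>
  have \<kappa>: "0 < \<kappa>"
  proof -
    obtain x where x: "x \<in> D" "x \<noteq> 0" "F x = complex_of_real lam *\<^sub>C x"
      using lamD by (auto simp: discrete_spectrum_def eigenvalue_def)
    have "range (E {lam}) \<subseteq> power_kernel A (complex_of_real lam) 1"
      using E_singleton_eigenvector[of lam] by auto
    then have "range (E {lam}) \<subseteq> generalized_eigenspace A (complex_of_real lam)"
      unfolding generalized_eigenspace_def by blast
    \<comment> \<open>Without a component at \<open>lam\<close>, the eigenvector \<open>x\<close>
      would lie in the complement, where the gap \<open>2 * r\<close> makes \<open>A - lam\<close>
      injective.\<close>
    moreover have "E {lam} x \<noteq> 0"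
    proof
      assume "E {lam} x = 0"
      then have "E (- {lam}) x = x" by (simp add: E_Compl)
      moreover have "{lam - 2 * r..lam + 2 * r} \<inter> - {lam} = {lam - 2 * r..lam + 2 * r} - {lam}"
        by blast
      ultimately have "E {lam - 2 * r..lam + 2 * r} x = 0"
        using E_Int[of "{lam - 2 * r..lam + 2 * r}" "- {lam}" x] iso by simp
      then have "2 * r * norm x \<le> norm (F x - complex_of_real lam *\<^sub>C x)"
        using x(1) assms(12) by (intro norm_ge_of_gap) auto
      then show False using x assms(12) by (simp add: mult_le_0_iff)
    qed
    ultimately show ?thesis
      unfolding assms(11) using lamD
      by (intro complex_dim_pos[where x = "E {lam} x"]) (auto simp: discrete_spectrum_def)
  qed
  obtain \<delta> where \<delta>: "\<delta> > 0" "\<And>z. z \<in> cball (complex_of_real lam + \<i>) (2 * r) \<Longrightarrow>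
      (Re z - a) * (Re z - b) + Im z * (1 - Im z) \<le> - \<delta>"
    using cball_inside_Gamma_curve[OF lam assms(15)] assms(12) by auto
  define C where "C = 1 + (b - a + 2) / \<delta>"
  \<comment> \<open>Valid for every \<open>n\<close> and every eigenvalue in the open disc; large
    \<open>n\<close> enters only through the enumeration of the eigenvalues.\<close>
  have bound: "cmod (complex_of_real lam + \<i> - z) \<le> C * (\<epsilon> n)\<^sup>2"
    if z: "z \<in> ball (complex_of_real lam + \<i>) r" "eigenvalue (add_i_times A (P n)) z" for n z
  proof -
    have d: "cmod (complex_of_real lam + \<i> - z) \<le> r"
      using z(1) by (simp add: dist_norm)
    obtain u where u: "u \<in> D" "u \<noteq> 0" "F u + \<i> *\<^sub>C P n u = z *\<^sub>C u"
      using z(2) by (auto simp: eigenvalue_def add_i_times_def)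
    \<comment> \<open>The absolute value provides the nonnegative constant that the estimate asks
      for; squaring removes it again.\<close>
    have K: "norm (E {a..b} x - P n (E {a..b} x)) \<le> \<bar>\<epsilon> n\<bar> * norm (E {a..b} x)" for x
    proof -
      have "norm (E {a..b} x - P n (E {a..b} x)) \<le> \<epsilon> n * norm (E {a..b} x)"
        unfolding assms(18) by (rule norm_diff_projection_le_gap[OF assms(16) E_proj]) simp
      also have "\<dots> \<le> \<bar>\<epsilon> n\<bar> * norm (E {a..b} x)"
        by (intro mult_right_mono) auto
      finally show ?thesis .
    qed
    have "\<bar>1 - Im z\<bar> \<le> r"
      using d abs_Im_le_cmod[of "complex_of_real lam + \<i> - z"] by simp
    \<comment> \<open>\<open>1 - 2 * Im z\<close> equals \<open>2 * (1 - Im z) - 1\<close>, so its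
      modulus is at most \<open>2 * r + 1\<close>.\<close>
    then have im: "\<bar>1 - 2 * Im z\<bar> \<le> 2"
      using assms(13) by linarith
    have "z \<in> cball (complex_of_real lam + \<i>) (2 * r)"
      using d assms(12) by (simp add: dist_norm)
    then have "cmod (complex_of_real lam + \<i> - z) \<le> C * \<bar>\<epsilon> n\<bar>\<^sup>2"
      unfolding C_def
      by (intro eigenvalue_estimate[OF assms(16,4) abs_ge_zero K iso d im \<delta>(1) \<delta>(2) u])
    then show ?thesis by simp
  qed
  show ?thesis
  proof (rule bigoI[where c = C])
    show "\<forall>\<^sub>F n in sequentially. norm (Max ((\<lambda>j. cmod (complex_of_real lam + \<i> - \<mu> n j)) ` {1..\<kappa>}))
        \<le> C * norm ((\<epsilon> n)\<^sup>2)"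
      using assms(19)
    proof eventually_elim
      case (elim n)
      let ?M = "(\<lambda>j. cmod (complex_of_real lam + \<i> - \<mu> n j)) ` {1..\<kappa>}"
      have "?M \<noteq> {}" using \<kappa> by simp
      then have M: "Max ?M \<in> ?M" by (intro Max_in) auto
      then obtain j where j: "j \<in> {1..\<kappa>}" "Max ?M = cmod (complex_of_real lam + \<i> - \<mu> n j)"
        by blast
      have "\<mu> n j \<in> {z \<in> ball (complex_of_real lam + \<i>) r. eigenvalue (add_i_times A (P n)) z}"
        using elim j(1) unfolding repeated_eigenvalues_in_def by blast
      then show ?case
        using bound[of "\<mu> n j" n] j(2) by simp
    qed
  qed
qed

end
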